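(* Let $F$ be a gerechte framework of order $n$ whose regions are all rectangles and which is arranged in a tree structure: for every region $R$ of $F$, the bottom set of $R$ is a union of complete regions of $F$. Then $F$ is realizable.
   Context: A gerechte framework of order $n$ is a partition of the cells of an $n\times n$ array into $n$ regions, each containing $n$ cells. A region is a rectangle if it consists of all cells lying in some set of consecutive rows and some set of consecutive columns. For a rectangular region $R$ occupying rows $a,\dots,b$ and columns $c,\dots,d$ (rows numbered from the top), the bottom set of $R$ is the set of cells in columns $c,\dots,d$ lying in rows strictly below row $b$ (i.e. rows $b+1,\dots,n$). A latin square of order $n$ is an $n\times n$ array with symbols $1,\dots,n$ in which each symbol appears exactly once in each row and once in each column. A latin square realizes a gerechte framework if, when its cells are partitioned by the framework, each region contains each symbol exactly once; a framework with such a latin square is called realizable. *)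

theory Defs
  imports Main "HOL-Library.Disjoint_Sets"
begin

text \<open>A cell is a pair (row, column), with rows numbered from the top, starting at 1.\<close>

definition cells :: "nat \<Rightarrow> (nat \<times> nat) set" where
  "cells n = {1..n} \<times> {1..n}"

definition gerechte_framework :: "nat \<Rightarrow> (nat \<times> nat) set set \<Rightarrow> bool" where
  "gerechte_framework n F \<longleftrightarrow>
     partition_on (cells n) F \<and> card F = n \<and> (\<forall>R\<in>F. card R = n)"

definition rectangle :: "(nat \<times> nat) set \<Rightarrow> bool" where
  "rectangle R \<longleftrightarrow> (\<exists>a b c d. a \<le> b \<and> c \<le> d \<and> R = {a..b} \<times> {c..d})"

text \<open>The bottom set is given by a formula that applies to any set of cells;
  the lemma below evaluates it on rectangles.\<close>

definition bottom_set :: "nat \<Rightarrow> (nat \<times> nat) set \<Rightarrow> (nat \<times> nat) set" where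
  "bottom_set n R = {(i, j) \<in> cells n. j \<in> snd ` R \<and> (\<forall>r \<in> fst ` R. r < i)}"

lemma bottom_set_rectangle:
  assumes "a \<le> b" "c \<le> d" "{a..b} \<times> {c..d} \<subseteq> cells n"
  shows "bottom_set n ({a..b} \<times> {c..d}) = {b + 1..n} \<times> {c..d}"
proof -
  have "1 \<le> c" "d \<le> n"
    using assms by (auto simp: cells_def times_subset_iff)
  moreover have "(\<forall>r\<in>{a..b}. r < i) \<longleftrightarrow> b < i" for i
    using assms(1) by auto
  ultimately show ?thesis
    using assms(1,2) by (auto simp: bottom_set_def cells_def)
qed

definition tree_structured :: "nat \<Rightarrow> (nat \<times> nat) set set \<Rightarrow> bool" where
  "tree_structured n F \<longleftrightarrow> (\<forall>R\<in>F. \<exists>G\<subseteq>F. bottom_set n R = \<Union>G)"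

text \<open>Arrays are functions on all pairs of naturals; only the values on
  \<^term>\<open>cells n\<close> matter.\<close>

definition latin_square :: "nat \<Rightarrow> (nat \<times> nat \<Rightarrow> nat) \<Rightarrow> bool" where
  "latin_square n L \<longleftrightarrow>
     (\<forall>x\<in>cells n. L x \<in> {1..n}) \<and>
     (\<forall>i\<in>{1..n}. \<forall>s\<in>{1..n}. \<exists>!j. j \<in> {1..n} \<and> L (i, j) = s) \<and>
     (\<forall>j\<in>{1..n}. \<forall>s\<in>{1..n}. \<exists>!i. i \<in> {1..n} \<and> L (i, j) = s)"

definition realizes :: "nat \<Rightarrow> (nat \<times> nat \<Rightarrow> nat) \<Rightarrow> (nat \<times> nat) set set \<Rightarrow> bool" where
  "realizes n L F \<longleftrightarrow>
     latin_square n L \<and> (\<forall>R\<in>F. \<forall>s\<in>{1..n}. \<exists>!x. x \<in> R \<and> L x = s)"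

definition realizable :: "nat \<Rightarrow> (nat \<times> nat) set set \<Rightarrow> bool" where
  "realizable n F \<longleftrightarrow> (\<exists>L. realizes n L F)"

end

theory Submission
  imports Defs
begin

text \<open>
  Colour the cells with \<open>n\<close> symbols so that rows and regions, whose sizes are all \<open>n\<close>, contain
  each symbol once: this is the decomposition into perfect matchings of the \<open>n\<close>-regular bipartite
  multigraph whose edges are the cells, each joining its row to its region. Exchanging entries that
  share both row and region keeps this property, and the tree structure allows one to repair the
  columns by such exchanges. Descend the tree, maintaining that in the strip formed by rows
  \<open>1..b\<close> of a column interval, where \<open>b\<close> is the last row of a region occupying exactly these
  columns, every symbol occurs equally often. When the regions below split the interval, the
  common frequency on each part has to be an integer because the part below is a union of regions
  of size \<open>n\<close>, and so a bipartite multigraph splitting theorem distributes the entries of each row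
  proportionally. At single columns of full height the frequency is one.
\<close>

section \<open>Equitable colourings of bipartite multigraphs\<close>

text \<open>Hall's theorem by Rado's argument: if some set has two elements, one of them can be removed
  without violating the condition, since two violations would contradict submodularity.\<close>

theorem marriage:
  fixes A :: "'i \<Rightarrow> 'a set"
  assumes "finite I" "\<And>i. i \<in> I \<Longrightarrow> finite (A i)"
    and "\<And>J. J \<subseteq> I \<Longrightarrow> card J \<le> card (\<Union>(A ` J))"
  shows "\<exists>f. inj_on f I \<and> (\<forall>i\<in>I. f i \<in> A i)"
  using assms(2,3)
proof (induction "\<Sum>i\<in>I. card (A i)" arbitrary: A rule: less_induct)
  case less
  note fin = less.prems(1) and hall = less.prems(2)
  have finU: "finite (\<Union>(A ` J))" if "J \<subseteq> I" for J
    using that fin \<open>finite I\<close> finite_subset by blast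
  show ?case
  proof (cases "\<exists>i\<in>I. \<exists>x\<in>A i. \<exists>y\<in>A i. x \<noteq> y")
    case False
    have "\<exists>x. x \<in> A i" if "i \<in> I" for i
      using hall[of "{i}"] that by (cases "A i = {}") auto
    then obtain f where f: "\<forall>i\<in>I. f i \<in> A i"
      by metis
    with False have single: "A i = {f i}" if "i \<in> I" for i
      using that by blast
    have "inj_on f I"
    proof
      fix i j assume ij: "i \<in> I" "j \<in> I" "f i = f j"
      then have "card {i, j} \<le> 1"
        using hall[of "{i, j}"] single by simp
      then show "i = j"
        by (cases "i = j") auto
    qed
    with f show ?thesis by blast
  next
    case True
    then obtain i x y where i: "i \<in> I" "x \<in> A i" "y \<in> A i" "x \<noteq> y"
      by blast
    \<comment> \<open>Deleting \<open>z\<close> from \<open>A i\<close> affects only index sets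
      containing \<open>i\<close>. The inequality in \<open>ok\<close> is strict because it is
      applied to such a set with \<open>i\<close> left out of \<open>J\<close>.\<close>
    have reduce: "\<exists>f. inj_on f I \<and> (\<forall>k\<in>I. f k \<in> A k)"
      if z: "z \<in> A i" and ok: "\<And>J. J \<subseteq> I - {i} \<Longrightarrow> card J < card (\<Union>(A ` J) \<union> (A i - {z}))" for z
    proof -
      define B where "B = A(i := A i - {z})"
      have "(\<Sum>k\<in>I. card (B k)) < (\<Sum>k\<in>I. card (A k))"
      proof (rule sum_strict_mono_ex1)
        show "\<forall>k\<in>I. card (B k) \<le> card (A k)"
          using fin by (auto simp: B_def intro: card_mono)
        show "\<exists>k\<in>I. card (B k) < card (A k)"
          using i(1) card_Diff1_less[OF fin[OF i(1)] z] by (intro bexI[of _ i]) (auto simp: B_def)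
      qed (fact \<open>finite I\<close>)
      moreover have "finite (B k)" if "k \<in> I" for k
        using fin that by (auto simp: B_def)
      moreover have "card J \<le> card (\<Union>(B ` J))" if J: "J \<subseteq> I" for J
      proof (cases "i \<in> J")
        case True
        have "\<Union>(B ` J) = \<Union>(A ` (J - {i})) \<union> (A i - {z})"
          using True by (auto simp: B_def split: if_splits)
        moreover have "card J = Suc (card (J - {i}))"
          using True J \<open>finite I\<close> by (metis card.remove finite_subset)
        ultimately show ?thesis
          using ok[of "J - {i}"] J by (simp add: Diff_mono)
      next
        case False
        then have "\<Union>(B ` J) = \<Union>(A ` J)"
          by (auto simp: B_def split: if_splits)
        then show ?thesis using hall J by simp
      qed
      ultimately obtain f where "inj_on f I" "\<forall>k\<in>I. f k \<in> B k"
        using less.hyps[of B] by blast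
      moreover have "B k \<subseteq> A k" for k by (auto simp: B_def)
      ultimately show ?thesis by blast
    qed
    show ?thesis
    proof (rule ccontr)
      assume no: "\<nexists>f. inj_on f I \<and> (\<forall>i\<in>I. f i \<in> A i)"
      obtain J where J: "J \<subseteq> I - {i}" "card (\<Union>(A ` J) \<union> (A i - {x})) \<le> card J"
        using no reduce[OF i(2)] not_less by blast
      obtain K where K: "K \<subseteq> I - {i}" "card (\<Union>(A ` K) \<union> (A i - {y})) \<le> card K"
        using no reduce[OF i(3)] not_less by blast
      let ?X = "\<Union>(A ` J) \<union> (A i - {x})" and ?Y = "\<Union>(A ` K) \<union> (A i - {y})"
      have finXY: "finite ?X" "finite ?Y"
        using J K finU[of J] finU[of K] fin i(1) by auto
      have finJK: "finite J" "finite K"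
        using J K \<open>finite I\<close> by (meson finite_Diff finite_subset)+
      \<comment> \<open>Since \<open>x\<close> and \<open>y\<close> differ, the union recovers all
        of \<open>A i\<close>, while the intersection contains every set indexed by
        \<open>J \<inter> K\<close>. Hall's condition for both gives
        \<open>card J + card K + 1 \<le> card ?X + card ?Y\<close>, contradicting the two
        violations.\<close>
      have "?X \<union> ?Y = \<Union>(A ` insert i (J \<union> K))"
        using i by auto
      moreover have "card (insert i (J \<union> K)) = Suc (card (J \<union> K))"
        using J K finJK by (intro card_insert_disjoint) auto
      moreover have "insert i (J \<union> K) \<subseteq> I" using J K i by auto
      ultimately have 1: "Suc (card (J \<union> K)) \<le> card (?X \<union> ?Y)"
        using hall[of "insert i (J \<union> K)"] by metis
      have "card (J \<inter> K) \<le> card (\<Union>(A ` (J \<inter> K)))"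
        using J by (intro hall) auto
      also have "\<dots> \<le> card (?X \<inter> ?Y)"
        using finXY by (intro card_mono) auto
      finally have 2: "card (J \<inter> K) \<le> card (?X \<inter> ?Y)" .
      show False
        using 1 2 J(2) K(2) card_Un_Int[OF finXY] card_Un_Int[OF finJK] by linarith
    qed
  qed
qed

section \<open>Perfect matchings and proportional edge classes\<close>

lemma card_eq_mult_card_image:
  assumes "finite E" "\<And>a. a \<in> u ` E \<Longrightarrow> card {e \<in> E. u e = a} = p"
  shows "card E = p * card (u ` E)"
proof -
  have "card E = (\<Sum>a\<in>u ` E. card {e \<in> E. u e = a})"
    using sum.image_gen[OF assms(1), of "\<lambda>_. 1::nat" u] by simp
  also have "\<dots> = p * card (u ` E)"
    using assms(2) by simp
  finally show ?thesis .
qed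

text \<open>A bipartite multigraph is a set of edges \<open>E\<close> with endpoint maps \<open>u\<close> and \<open>v\<close>; degrees are the
  cardinalities of fibres.\<close>

lemma regular_transversal:
  fixes u :: "'e \<Rightarrow> 'a" and v :: "'e \<Rightarrow> 'b"
  assumes "finite E" "0 < p"
    and u: "\<And>a. a \<in> u ` E \<Longrightarrow> card {e \<in> E. u e = a} = p"
    and v: "\<And>b. b \<in> v ` E \<Longrightarrow> card {e \<in> E. v e = b} = p"
  obtains C where "C \<subseteq> E" "inj_on u C" "u ` C = u ` E" "inj_on v C" "v ` C = v ` E"
proof -
  define A where "A a = v ` {e \<in> E. u e = a}" for a
  have "\<exists>f. inj_on f (u ` E) \<and> (\<forall>a\<in>u ` E. f a \<in> A a)"
  proof (rule marriage)
    fix J assume J: "J \<subseteq> u ` E"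
    \<comment> \<open>Double counting: \<open>X\<close> consists of the edges at \<open>J\<close>,
      and \<open>Y\<close> of all edges at the neighbours of \<open>J\<close>. Thus
      \<open>X \<subseteq> Y\<close>, and by regularity their sizes are \<open>p\<close> times the
      numbers of vertices concerned.\<close>
    define X where "X = {e \<in> E. u e \<in> J}"
    define Y where "Y = {e \<in> E. v e \<in> v ` X}"
    have uX: "u ` X = J" using J by (auto simp: X_def)
    have vY: "v ` Y = v ` X" by (auto simp: Y_def X_def)
    have "card X = p * card (u ` X)"
    proof (rule card_eq_mult_card_image)
      fix a assume a: "a \<in> u ` X"
      then have "{e \<in> X. u e = a} = {e \<in> E. u e = a}" by (auto simp: X_def)
      then show "card {e \<in> X. u e = a} = p" using u[of a] a by (auto simp: X_def)
    qed (simp add: X_def \<open>finite E\<close>)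
    moreover have "card Y = p * card (v ` Y)"
    proof (rule card_eq_mult_card_image)
      fix b assume b: "b \<in> v ` Y"
      then have "{e \<in> Y. v e = b} = {e \<in> E. v e = b}" by (auto simp: Y_def)
      then show "card {e \<in> Y. v e = b} = p" using v[of b] b by (auto simp: Y_def)
    qed (simp add: Y_def \<open>finite E\<close>)
    moreover have "card X \<le> card Y"
      using \<open>finite E\<close> by (intro card_mono) (auto simp: X_def Y_def)
    moreover have "\<Union>(A ` J) = v ` X"
      by (auto simp: A_def X_def)
    ultimately show "card J \<le> card (\<Union>(A ` J))"
      using \<open>0 < p\<close> uX vY by simp
  qed (auto simp: A_def \<open>finite E\<close>)
  then obtain f where f: "inj_on f (u ` E)" "\<forall>a\<in>u ` E. f a \<in> A a"
    by blast
  have "\<forall>a\<in>u ` E. \<exists>e\<in>E. u e = a \<and> v e = f a"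
    using f(2) by (force simp: A_def)
  then obtain g where g: "\<forall>a\<in>u ` E. g a \<in> E \<and> u (g a) = a \<and> v (g a) = f a"
    by metis
  \<comment> \<open>Both sides have \<open>card E\<close> divided by \<open>p\<close> vertices, so a
    matching that saturates one side saturates the other.\<close>
  have "f ` u ` E = v ` E"
  proof (rule card_subset_eq)
    show "f ` u ` E \<subseteq> v ` E" using g by (metis image_subsetI imageI)
    have "p * card (u ` E) = p * card (v ` E)"
      using card_eq_mult_card_image[OF \<open>finite E\<close> u] card_eq_mult_card_image[OF \<open>finite E\<close> v]
      by metis
    then show "card (f ` u ` E) = card (v ` E)"
      using \<open>0 < p\<close> card_image[OF f(1)] by simp
  qed (simp add: \<open>finite E\<close>)
  moreover have "u ` g ` u ` E = u ` E" "v ` g ` u ` E = f ` u ` E"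
    using g by (force simp: image_image)+
  moreover have "inj_on u (g ` u ` E)" "inj_on v (g ` u ` E)"
    by (rule inj_on_imageI, rule inj_onI, use g f(1) in \<open>simp add: inj_on_eq_iff\<close>)+
  moreover have "g ` u ` E \<subseteq> E" using g by blast
  ultimately show ?thesis
    by (intro that[of "g ` u ` E"]) simp_all
qed

text \<open>Reduces divisible degrees to regular ones: the edges at a vertex are numbered and cut
  into consecutive blocks of length \<open>p\<close>, and each block becomes a separate copy of the
  vertex, tagged with the block number.\<close>

lemma split_fibres:
  fixes u :: "'e \<Rightarrow> 'a"
  assumes "finite E" "0 < p" and dvd: "\<And>a. p dvd card {e \<in> E. u e = a}"
  obtains u' :: "'e \<Rightarrow> 'a \<times> nat" where "\<And>e. fst (u' e) = u e"
    "\<And>a. a \<in> u' ` E \<Longrightarrow> card {e \<in> E. u' e = a} = p"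
proof -
  have "\<forall>a. \<exists>h. bij_betw h {e \<in> E. u e = a} {0..<card {e \<in> E. u e = a}}"
    using \<open>finite E\<close> by (intro allI ex_bij_betw_finite_nat) simp
  then obtain h where h: "\<And>a. bij_betw (h a) {e \<in> E. u e = a} {0..<card {e \<in> E. u e = a}}"
    by metis
  define u' where "u' e = (u e, h (u e) e div p)" for e
  have "card {e \<in> E. u' e = a'} = p" if "a' \<in> u' ` E" for a'
  proof -
    obtain e0 where e0: "e0 \<in> E" "a' = u' e0" using \<open>a' \<in> u' ` E\<close> by blast
    define a where "a = u e0"
    define q where "q = h a e0 div p"
    obtain m where m: "card {e \<in> E. u e = a} = p * m"
      using dvd by (meson dvdE)
    have "h a e0 < p * m"
      using bij_betwE[OF h[of a]] e0 m by (auto simp: a_def)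
    then have "q < m" using \<open>0 < p\<close>
      by (simp add: q_def less_mult_imp_div_less mult.commute)
    \<comment> \<open>Block \<open>q\<close> ends no later than \<open>p * m\<close>, so it is not
      truncated and has exactly \<open>p\<close> members.\<close>
    then have "p * q + p \<le> p * m" by (metis Suc_leI mult_Suc_right mult_le_mono2 add.commute)
    have 1: "{e \<in> E. u' e = a'} = {e \<in> {e \<in> E. u e = a}. h a e div p = q}"
      using e0 by (auto simp: u'_def a_def q_def)
    have 2: "bij_betw (h a) {e \<in> {e \<in> E. u e = a}. h a e div p = q} {k \<in> {0..<p * m}. k div p = q}"
      using h[of a] m unfolding bij_betw_def by (auto simp: inj_on_def)
    have "k div p = q \<longleftrightarrow> p * q \<le> k \<and> k < p * q + p" for k
      using \<open>0 < p\<close> dividend_less_times_div[of p k] times_div_less_eq_dividend[of p k]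
      by (auto simp: add.commute intro!: div_nat_eqI)
    then have 3: "{k \<in> {0..<p * m}. k div p = q} = {p * q..<p * q + p}"
      using \<open>p * q + p \<le> p * m\<close> less_le_trans by fastforce
    show ?thesis
      unfolding 1 bij_betw_same_card[OF 2] 3 by simp
  qed
  then show ?thesis
    by (intro that[of u']) (auto simp: u'_def)
qed

text \<open>Once the vertices on both sides are split into copies of degree \<open>p\<close>, a
  perfect matching meets every copy exactly once. At an original vertex it therefore uses one edge
  out of every \<open>p\<close>.\<close>

lemma proportional_class:
  fixes u :: "'e \<Rightarrow> 'a" and v :: "'e \<Rightarrow> 'b"
  assumes "finite E" "0 < p"
    and u: "\<And>a. p dvd card {e \<in> E. u e = a}"
    and v: "\<And>b. p dvd card {e \<in> E. v e = b}"
  obtains C where "C \<subseteq> E" "\<And>a. card {e \<in> E. u e = a} = p * card {e \<in> C. u e = a}"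
    "\<And>b. card {e \<in> E. v e = b} = p * card {e \<in> C. v e = b}"
proof -
  obtain u' :: "'e \<Rightarrow> 'a \<times> nat" where u': "\<And>e. fst (u' e) = u e"
    "\<And>a. a \<in> u' ` E \<Longrightarrow> card {e \<in> E. u' e = a} = p"
    using split_fibres[of E p u] assms by metis
  obtain v' :: "'e \<Rightarrow> 'b \<times> nat" where v': "\<And>e. fst (v' e) = v e"
    "\<And>b. b \<in> v' ` E \<Longrightarrow> card {e \<in> E. v' e = b} = p"
    using split_fibres[of E p v] assms by metis
  obtain C where C: "C \<subseteq> E" "inj_on u' C" "u' ` C = u' ` E" "inj_on v' C" "v' ` C = v' ` E"
    by (rule regular_transversal[OF assms(1,2) u'(2) v'(2)])
  \<comment> \<open>The endpoint map is kept arbitrary so that one argument serves both sides: the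
    degree of \<open>a\<close> is \<open>p\<close> times its number of copies, and \<open>C\<close>
    has one edge at each copy.\<close>
  have count: "card {e \<in> E. w e = a} = p * card {e \<in> C. w e = a}"
    if w': "\<And>e. fst (w' e) = w e" "\<And>a. a \<in> w' ` E \<Longrightarrow> card {e \<in> E. w' e = a} = p"
      and inj: "inj_on w' C" and im: "w' ` C = w' ` E"
    for w :: "'e \<Rightarrow> 'c" and w' :: "'e \<Rightarrow> 'c \<times> nat" and a
  proof -
    let ?F = "{e \<in> E. w e = a}"
    have "card ?F = p * card (w' ` ?F)"
    proof (rule card_eq_mult_card_image)
      fix b assume b: "b \<in> w' ` ?F"
      then have "{e \<in> ?F. w' e = b} = {e \<in> E. w' e = b}"
        using w'(1) by (metis (mono_tags, lifting) imageE mem_Collect_eq)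
      then show "card {e \<in> ?F. w' e = b} = p" using w'(2)[of b] b by auto
    qed (simp add: \<open>finite E\<close>)
    also have "w' ` ?F = w' ` {e \<in> C. w e = a}"
    proof
      show "w' ` ?F \<subseteq> w' ` {e \<in> C. w e = a}"
      proof
        fix b assume "b \<in> w' ` ?F"
        then obtain e where e: "e \<in> E" "w e = a" "b = w' e" by blast
        then obtain e' where "e' \<in> C" "w' e' = w' e" using im by (metis imageE imageI)
        then show "b \<in> w' ` {e \<in> C. w e = a}"
          using e w'(1) by (metis (mono_tags, lifting) imageI mem_Collect_eq)
      qed
    qed (use C(1) in auto)
    also have "card \<dots> = card {e \<in> C. w e = a}"
      by (rule card_image) (use inj in \<open>auto simp: inj_on_def\<close>)
    finally show ?thesis .
  qed
  show ?thesis
    using that[OF C(1)] count[OF u' C(2,3)] count[OF v' C(4,5)] by blast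
qed

text \<open>Induction on the number of colours. With \<open>p + 1\<close> colours, a proportional
  class \<open>C\<close> becomes one colour; the degree left at each vertex is \<open>p\<close>
  times the degree in \<open>C\<close>, so the induction hypothesis colours the rest with
  \<open>p\<close> colours.\<close>

lemma equitable_colouring:
  fixes u :: "'e \<Rightarrow> 'a" and v :: "'e \<Rightarrow> 'b"
  assumes "finite E" "0 < p"
    and "\<And>a. p dvd card {e \<in> E. u e = a}"
    and "\<And>b. p dvd card {e \<in> E. v e = b}"
  shows "\<exists>col. (\<forall>e\<in>E. col e < p) \<and>
    (\<forall>c<p. \<forall>a. card {e \<in> E. u e = a} = p * card {e \<in> E. u e = a \<and> col e = c}) \<and>
    (\<forall>c<p. \<forall>b. card {e \<in> E. v e = b} = p * card {e \<in> E. v e = b \<and> col e = c})"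
  using assms(2,1,3,4)
proof (induction p arbitrary: E rule: nat_induct_non_zero)
  case 1
  show ?case by (rule exI[of _ "\<lambda>_. 0"]) simp
next
  case (Suc p)
  obtain C where C: "C \<subseteq> E"
    "\<And>a. card {e \<in> E. u e = a} = Suc p * card {e \<in> C. u e = a}"
    "\<And>b. card {e \<in> E. v e = b} = Suc p * card {e \<in> C. v e = b}"
    by (rule proportional_class[of E "Suc p" u v, OF Suc.prems(1) zero_less_Suc Suc.prems(2,3)]) blast
  have rest: "card {e \<in> E - C. w e = a} = p * card {e \<in> C. w e = a}"
    if "card {e \<in> E. w e = a} = Suc p * card {e \<in> C. w e = a}" for w :: "'e \<Rightarrow> 'c" and a
  proof -
    have "{e \<in> E - C. w e = a} = {e \<in> E. w e = a} - {e \<in> C. w e = a}" by auto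
    moreover have "finite {e \<in> C. w e = a}" "{e \<in> C. w e = a} \<subseteq> {e \<in> E. w e = a}"
      using C(1) finite_subset[OF C(1) \<open>finite E\<close>] by auto
    ultimately show ?thesis
      using that by (simp add: card_Diff_subset)
  qed
  have "finite (E - C)" "\<And>a. p dvd card {e \<in> E - C. u e = a}" "\<And>b. p dvd card {e \<in> E - C. v e = b}"
    using Suc.prems(1) rest[of u, OF C(2)] rest[of v, OF C(3)] by simp_all
  from Suc.IH[OF this] obtain col where col: "\<forall>e\<in>E - C. col e < p"
    "\<And>c a. c < p \<Longrightarrow> card {e \<in> E - C. u e = a} = p * card {e \<in> E - C. u e = a \<and> col e = c}"
    "\<And>c b. c < p \<Longrightarrow> card {e \<in> E - C. v e = b} = p * card {e \<in> E - C. v e = b \<and> col e = c}"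
    by blast
  \<comment> \<open>The induction hypothesis uses the colours below \<open>p\<close>, which leaves
    \<open>p\<close> itself free for the class \<open>C\<close>.\<close>
  define col' where "col' e = (if e \<in> C then p else col e)" for e
  have count: "card {e \<in> E. w e = a} = Suc p * card {e \<in> E. w e = a \<and> col' e = c}"
    if tot: "card {e \<in> E. w e = a} = Suc p * card {e \<in> C. w e = a}"
      and cl: "\<And>c. c < p \<Longrightarrow> card {e \<in> E - C. w e = a} = p * card {e \<in> E - C. w e = a \<and> col e = c}"
      and "c < Suc p" for w :: "'e \<Rightarrow> 'c" and a c
  proof (cases "c = p")
    case True
    then have "{e \<in> E. w e = a \<and> col' e = c} = {e \<in> C. w e = a}"
      using C(1) col(1) by (auto simp: col'_def)
    then show ?thesis using tot by simp
  next
    case False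
    then have "c < p" using \<open>c < Suc p\<close> by simp
    then have "{e \<in> E. w e = a \<and> col' e = c} = {e \<in> E - C. w e = a \<and> col e = c}"
      by (auto simp: col'_def)
    \<comment> \<open>Both numbers are the \<open>p\<close>-th part of the degree outside
      \<open>C\<close>, so an old colour is as frequent at each vertex as the new one.\<close>
    moreover have "card {e \<in> C. w e = a} = card {e \<in> E - C. w e = a \<and> col e = c}"
      using cl[OF \<open>c < p\<close>] rest[OF tot] \<open>c < p\<close> by simp
    ultimately show ?thesis using tot by simp
  qed
  have "\<forall>e\<in>E. col' e < Suc p"
    using col(1) by (auto simp: col'_def less_Suc_eq)
  then show ?case
    using count[of u, OF C(2) col(2)] count[of v, OF C(3) col(3)] by blast
qed

text \<open>Write \<open>x / w\<close> in lowest terms as \<open>y / p\<close>. The divisibility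
  hypotheses then say that \<open>p\<close> divides every degree, and \<open>D\<close> is the union
  of \<open>y\<close> of the \<open>p\<close> classes of an equitable colouring.\<close>

lemma proportional_split:
  fixes u :: "'e \<Rightarrow> 'a" and v :: "'e \<Rightarrow> 'b"
  assumes "finite E" "0 < w"
    and u: "\<And>a. w dvd x * card {e \<in> E. u e = a}"
    and v: "\<And>b. w dvd x * card {e \<in> E. v e = b}"
    and "x \<le> w"
  obtains D where "D \<subseteq> E"
    "\<And>a. w * card {e \<in> D. u e = a} = x * card {e \<in> E. u e = a}"
    "\<And>b. w * card {e \<in> D. v e = b} = x * card {e \<in> E. v e = b}"
proof -
  define g where "g = gcd w x"
  obtain p y where py: "w = g * p" "x = g * y" "coprime p y"
    using \<open>0 < w\<close> unfolding g_def
    by (metis gcd_coprime_exists gcd_nat.neutr_eq_iff less_numeral_extra(3) mult.commute)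
  have "0 < g" "0 < p" using \<open>0 < w\<close> py by auto
  have "y \<le> p" using \<open>x \<le> w\<close> \<open>0 < g\<close> py by simp
  have dvd: "p dvd k" if "w dvd x * k" for k
    using that py \<open>0 < g\<close> by (auto simp: mult.assoc coprime_dvd_mult_right_iff)
  obtain col where col: "\<forall>e\<in>E. col e < p"
    "\<And>c a. c < p \<Longrightarrow> card {e \<in> E. u e = a} = p * card {e \<in> E. u e = a \<and> col e = c}"
    "\<And>c b. c < p \<Longrightarrow> card {e \<in> E. v e = b} = p * card {e \<in> E. v e = b \<and> col e = c}"
    using equitable_colouring[of E p u v, OF \<open>finite E\<close> \<open>0 < p\<close> dvd[OF u] dvd[OF v]] by blast
  have count: "w * card {e \<in> {e \<in> E. col e < y}. z e = a} = x * card {e \<in> E. z e = a}"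
    if z: "\<And>c. c < p \<Longrightarrow> card {e \<in> E. z e = a} = p * card {e \<in> E. z e = a \<and> col e = c}"
    for z :: "'e \<Rightarrow> 'c" and a
  proof -
    have "{e \<in> {e \<in> E. col e < y}. z e = a} = (\<Union>c<y. {e \<in> E. z e = a \<and> col e = c})"
      by auto
    also have "card \<dots> = (\<Sum>c<y. card {e \<in> E. z e = a \<and> col e = c})"
      using \<open>finite E\<close> by (intro card_UN_disjoint) auto
    finally have "p * card {e \<in> {e \<in> E. col e < y}. z e = a} = (\<Sum>c<y. p * card {e \<in> E. z e = a \<and> col e = c})"
      by (simp add: sum_distrib_left)
    also have "\<dots> = (\<Sum>c<y. card {e \<in> E. z e = a})"
      using z \<open>y \<le> p\<close> by (intro sum.cong) (auto dest: less_le_trans)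
    finally show ?thesis by (simp add: py)
  qed
  show ?thesis
    using that[of "{e \<in> E. col e < y}"] count[of u, OF col(2)] count[of v, OF col(3)] by blast
qed

section \<open>Rearranging entries within rows of regions\<close>

text \<open>For a set of cells of a framework this means being a union of regions. Stated region by
  region, without naming the subfamily, it passes to differences at once.\<close>

definition respects_regions :: "(nat \<times> nat) set set \<Rightarrow> (nat \<times> nat) set \<Rightarrow> bool" where
  "respects_regions F Z \<longleftrightarrow> (\<forall>R\<in>F. R \<subseteq> Z \<or> R \<inter> Z = {})"

lemma respects_regionsD:
  assumes "respects_regions F Z" "R \<in> F" "x \<in> R" "x \<in> Z"
  shows "R \<subseteq> Z"
  using assms unfolding respects_regions_def by blast

lemma respects_regions_Diff:
  assumes "respects_regions F Z" "respects_regions F W"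
  shows "respects_regions F (Z - W)"
  using assms unfolding respects_regions_def by blast

lemma respects_regions_Union:
  assumes "disjoint F" "G \<subseteq> F"
  shows "respects_regions F (\<Union>G)"
  unfolding respects_regions_def
proof
  fix R assume "R \<in> F"
  then show "R \<subseteq> \<Union>G \<or> R \<inter> \<Union>G = {}"
    using disjointD[OF assms(1), of R] assms(2) by (cases "R \<in> G") blast+
qed

text \<open>In a strip, the rows up to \<open>b\<close> of the column interval \<open>{c..d}\<close> lie within regions extending over
  all of these columns, while the cells below row \<open>b\<close> form a union of regions.\<close>

definition balanced_strip ::
  "nat \<Rightarrow> (nat \<times> nat) set set \<Rightarrow> nat \<Rightarrow> nat \<Rightarrow> nat \<Rightarrow> (nat \<times> nat \<Rightarrow> nat) \<Rightarrow> bool" where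
  "balanced_strip n F b c d L \<longleftrightarrow>
     1 \<le> c \<and> c \<le> d \<and> d \<le> n \<and> b \<le> n \<and>
     respects_regions F ({b + 1..n} \<times> {c..d}) \<and>
     (\<forall>R\<in>F. R \<subseteq> {b + 1..n} \<times> {c..d} \<longrightarrow> bij_betw L R {1..n}) \<and>
     (\<forall>i\<in>{1..b}. inj_on L ({i} \<times> {c..d}) \<and> L ` ({i} \<times> {c..d}) \<subseteq> {1..n}) \<and>
     (\<forall>s\<in>{1..n}. n * card {x \<in> {1..b} \<times> {c..d}. L x = s} = b * (d + 1 - c))"

text \<open>The goal of the descent on one strip. Above the boundary row, symbols may move anywhere
  within a row of the strip; below it, only within the part of a row inside one region. Comparing
  images rather than giving permutations lets solutions on adjacent strips be glued by taking
  unions.\<close>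

definition column_latin_rearrangement ::
  "nat \<Rightarrow> (nat \<times> nat) set set \<Rightarrow> nat \<Rightarrow> nat \<Rightarrow> nat \<Rightarrow> (nat \<times> nat \<Rightarrow> nat) \<Rightarrow> (nat \<times> nat \<Rightarrow> nat) \<Rightarrow> bool" where
  "column_latin_rearrangement n F b c d L L' \<longleftrightarrow>
     (\<forall>i\<in>{1..b}. L' ` ({i} \<times> {c..d}) = L ` ({i} \<times> {c..d})) \<and>
     (\<forall>R\<in>F. R \<subseteq> {b + 1..n} \<times> {c..d} \<longrightarrow>
        (\<forall>i. L' ` (R \<inter> {i} \<times> UNIV) = L ` (R \<inter> {i} \<times> UNIV))) \<and>
     (\<forall>j\<in>{c..d}. bij_betw (\<lambda>i. L' (i, j)) {1..n} {1..n})"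

text \<open>Turns a selection \<open>D\<close> of cells into an actual strip on fewer columns: in
  each row up to \<open>b\<close> the selected entries are moved into the narrower interval, which
  preserves the frequency of every symbol. Nothing below row \<open>b\<close> is moved.\<close>

lemma balanced_substrip:
  assumes bal: "balanced_strip n F b c d L"
    and sub: "c \<le> c'" "c' \<le> d'" "d' \<le> d"
    and reg: "respects_regions F ({b + 1..n} \<times> {c'..d'})"
    and D: "D \<subseteq> {1..b} \<times> {c..d}"
    and row: "\<And>i. i \<in> {1..b} \<Longrightarrow> card {x \<in> D. fst x = i} = d' + 1 - c'"
    and sym: "\<And>s. s \<in> {1..n} \<Longrightarrow> n * card {x \<in> D. L x = s} = b * (d' + 1 - c')"
  obtains L' where "balanced_strip n F b c' d' L'"
    "\<And>i. i \<in> {1..b} \<Longrightarrow> L' ` ({i} \<times> {c'..d'}) = L ` {x \<in> D. fst x = i}"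
    "\<And>i j. b < i \<Longrightarrow> L' (i, j) = L (i, j)"
proof -
  have "finite D" using D finite_subset by blast
  have "\<forall>i\<in>{1..b}. \<exists>g. bij_betw g {c'..d'} {j. (i, j) \<in> D}"
  proof
    fix i assume i: "i \<in> {1..b}"
    have eq: "{x \<in> D. fst x = i} = Pair i ` {j. (i, j) \<in> D}" by force
    have "card {x \<in> D. fst x = i} = card {j. (i, j) \<in> D}"
      unfolding eq by (rule card_image) (simp add: inj_on_def)
    moreover have "finite {j. (i, j) \<in> D}"
      using D finite_subset[of "{j. (i, j) \<in> D}" "{c..d}"] by auto
    ultimately show "\<exists>g. bij_betw g {c'..d'} {j. (i, j) \<in> D}"
      using row[OF i] finite_same_card_bij[of "{c'..d'}" "{j. (i, j) \<in> D}"] by simp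
  qed
  then obtain g where g: "\<And>i. i \<in> {1..b} \<Longrightarrow> bij_betw (g i) {c'..d'} {j. (i, j) \<in> D}"
    by metis
  \<comment> \<open>\<open>h\<close> sends a cell of the narrower strip to the selected cell of the
    same row whose entry it receives.\<close>
  define h where "h x = (fst x, g (fst x) (snd x))" for x
  define L' where "L' x = (if fst x \<in> {1..b} then L (h x) else L x)" for x
  have rows: "h ` ({i} \<times> {c'..d'}) = {x \<in> D. fst x = i}" if "i \<in> {1..b}" for i
  proof -
    have "{i} \<times> {c'..d'} = Pair i ` {c'..d'}" by auto
    then have "h ` ({i} \<times> {c'..d'}) = Pair i ` g i ` {c'..d'}"
      by (simp add: h_def image_image)
    also have "\<dots> = Pair i ` {j. (i, j) \<in> D}"
      by (simp only: bij_betw_imp_surj_on[OF g[OF that]])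
    also have "\<dots> = {x \<in> D. fst x = i}" by force
    finally show ?thesis .
  qed
  have h: "bij_betw h ({1..b} \<times> {c'..d'}) D"
  proof (rule bij_betw_imageI)
    show "inj_on h ({1..b} \<times> {c'..d'})"
      using bij_betw_imp_inj_on[OF g] by (auto simp: inj_on_def h_def)
    have "{1..b} \<times> {c'..d'} = (\<Union>i\<in>{1..b}. {i} \<times> {c'..d'})" by auto
    then have "h ` ({1..b} \<times> {c'..d'}) = (\<Union>i\<in>{1..b}. {x \<in> D. fst x = i})"
      using rows by (simp add: image_UN)
    also have "\<dots> = D" using D by auto
    finally show "h ` ({1..b} \<times> {c'..d'}) = D" .
  qed
  have im: "L' ` ({i} \<times> {c'..d'}) = L ` {x \<in> D. fst x = i}" if "i \<in> {1..b}" for i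
  proof -
    have "L' ` ({i} \<times> {c'..d'}) = L ` h ` ({i} \<times> {c'..d'})"
      using that by (auto simp: L'_def image_image)
    then show ?thesis using rows[OF that] by simp
  qed
  have below: "L' (i, j) = L (i, j)" if "b < i" for i j
    using that by (simp add: L'_def)
  have "bij_betw L' R {1..n}" if R: "R \<in> F" "R \<subseteq> {b + 1..n} \<times> {c'..d'}" for R
  proof -
    have "R \<subseteq> {b + 1..n} \<times> {c..d}" using R(2) sub by fastforce
    then have "bij_betw L R {1..n}"
      using bal R(1) by (simp add: balanced_strip_def)
    moreover have "L' x = L x" if "x \<in> R" for x
      using that R(2) by (auto simp: L'_def)
    ultimately show ?thesis by (simp cong: bij_betw_cong)
  qed
  moreover have "inj_on L' ({i} \<times> {c'..d'}) \<and> L' ` ({i} \<times> {c'..d'}) \<subseteq> {1..n}" if i: "i \<in> {1..b}" for i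
  proof -
    have Di: "{x \<in> D. fst x = i} \<subseteq> {i} \<times> {c..d}" using D by auto
    have L: "inj_on L ({i} \<times> {c..d})" "L ` ({i} \<times> {c..d}) \<subseteq> {1..n}"
      using bal i by (simp_all add: balanced_strip_def)
    \<comment> \<open>Injectivity by counting: the row receives as many distinct symbols as it has
      cells.\<close>
    have "card (L' ` ({i} \<times> {c'..d'})) = card ({i} \<times> {c'..d'})"
      using im[OF i] card_image[OF inj_on_subset[OF L(1) Di]] row[OF i]
      by (simp add: card_cartesian_product)
    then have "inj_on L' ({i} \<times> {c'..d'})"
      by (intro eq_card_imp_inj_on) auto
    then show ?thesis using im[OF i] Di L(2) by blast
  qed
  moreover have "n * card {x \<in> {1..b} \<times> {c'..d'}. L' x = s} = b * (d' + 1 - c')"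
    if s: "s \<in> {1..n}" for s
  proof -
    have "bij_betw h {x \<in> {1..b} \<times> {c'..d'}. L' x = s} {x \<in> D. L x = s}"
    proof (rule bij_betw_imageI)
      show "inj_on h {x \<in> {1..b} \<times> {c'..d'}. L' x = s}"
        by (rule inj_on_subset[OF bij_betw_imp_inj_on[OF h]]) auto
      have "L' x = L (h x)" if "x \<in> {1..b} \<times> {c'..d'}" for x
        using that by (auto simp: L'_def)
      then show "h ` {x \<in> {1..b} \<times> {c'..d'}. L' x = s} = {x \<in> D. L x = s}"
        using bij_betw_imp_surj_on[OF h] by auto
    qed
    then show ?thesis using sym[OF s] by (simp only: bij_betw_same_card)
  qed
  ultimately have "balanced_strip n F b c' d' L'"
    using bal sub reg by (simp add: balanced_strip_def)
  then show ?thesis using that im below by blast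
qed

lemma respects_regions_card_dvd:
  assumes "gerechte_framework n F" "Z \<subseteq> cells n" "respects_regions F Z"
  shows "n dvd card Z"
proof -
  have P: "partition_on (cells n) F" "\<forall>R\<in>F. card R = n"
    using assms(1) by (auto simp: gerechte_framework_def)
  have "Z = \<Union>{R \<in> F. R \<subseteq> Z}"
  proof
    show "Z \<subseteq> \<Union>{R \<in> F. R \<subseteq> Z}"
    proof
      fix x assume x: "x \<in> Z"
      then obtain R where R: "R \<in> F" "x \<in> R"
        using assms(2) partition_onD1[OF P(1)] by blast
      then have "R \<subseteq> Z" using respects_regionsD[OF assms(3) R x] by simp
      then show "x \<in> \<Union>{R \<in> F. R \<subseteq> Z}" using R by blast
    qed
  qed blast
  moreover have "card (\<Union>{R \<in> F. R \<subseteq> Z}) = sum card {R \<in> F. R \<subseteq> Z}"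
  proof (rule card_Union_disjoint)
    show "pairwise disjnt {R \<in> F. R \<subseteq> Z}"
      using disjointD[OF partition_onD2[OF P(1)]] by (simp add: pairwise_def disjnt_def)
    have "finite (cells n)" by (simp add: cells_def)
    then show "finite R" if "R \<in> {R \<in> F. R \<subseteq> Z}" for R
      using that assms(2) by (blast intro: finite_subset)
  qed
  moreover have "n dvd sum card {R \<in> F. R \<subseteq> Z}"
    using P(2) by (intro dvd_sum) simp
  ultimately show ?thesis by simp
qed

section \<open>Descent of the tree: dividing strips and absorbing regions\<close>

text \<open>The entries above the boundary form a bipartite multigraph between rows and symbols.
  Splitting it in the ratio of the two widths gives the set \<open>D\<close> for the left part and
  its complement for the right part. Both parts are balanced, narrower strips, and their
  rearrangements are glued along column \<open>e\<close>.\<close>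

lemma split_strip:
  assumes G: "gerechte_framework n F"
    and bal: "balanced_strip n F b c d L"
    and e: "c \<le> e" "e < d"
    and reg: "respects_regions F ({b + 1..n} \<times> {c..e})"
    and IH: "\<And>c' d' L. d' - c' < d - c \<Longrightarrow> balanced_strip n F b c' d' L \<Longrightarrow>
       \<exists>L'. column_latin_rearrangement n F b c' d' L L'"
  shows "\<exists>L'. column_latin_rearrangement n F b c d L L'"
proof -
  define w where "w = d + 1 - c"
  define x where "x = e + 1 - c"
  have wx: "0 < w" "x \<le> w" "d + 1 - (e + 1) = w - x"
    using e by (auto simp: w_def x_def)
  define E where "E = {1..b} \<times> {c..d}"
  have finE: "finite E" by (simp add: E_def)
  have bnd: "1 \<le> c" "d \<le> n" "b \<le> n" and n: "0 < n"
    and regZ: "respects_regions F ({b + 1..n} \<times> {c..d})"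
    and inj: "\<And>i. i \<in> {1..b} \<Longrightarrow> inj_on L ({i} \<times> {c..d})"
    and rng: "\<And>i. i \<in> {1..b} \<Longrightarrow> L ` ({i} \<times> {c..d}) \<subseteq> {1..n}"
    and cnt: "\<And>s. s \<in> {1..n} \<Longrightarrow> n * card {y \<in> E. L y = s} = b * w"
    using bal e by (auto simp: balanced_strip_def E_def w_def)
  \<comment> \<open>The block below has area \<open>(n - b) * x\<close>. As it is a union of
    regions, \<open>n\<close> divides \<open>b * x\<close>, and the quotient \<open>k\<close> is the
    frequency that every symbol must have on the left part.\<close>
  have "n dvd card ({b + 1..n} \<times> {c..e})"
    using bnd e by (intro respects_regions_card_dvd[OF G _ reg]) (auto simp: cells_def)
  then have "n dvd n * x - b * x"
    using \<open>b \<le> n\<close> by (simp add: card_cartesian_product x_def diff_mult_distrib)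
  then have "n dvd b * x"
    using \<open>b \<le> n\<close> by (metis dvd_diffD1 dvd_triv_left mult_le_mono1)
  then obtain k where k: "b * x = n * k" by blast
  have row: "card {y \<in> E. fst y = i} = (if i \<in> {1..b} then w else 0)" for i
  proof -
    have "{y \<in> E. fst y = i} = (if i \<in> {1..b} then {i} \<times> {c..d} else {})"
      by (auto simp: E_def)
    then show ?thesis by (simp add: card_cartesian_product w_def)
  qed
  have "w dvd x * card {y \<in> E. L y = s}" for s
  proof (cases "s \<in> {1..n}")
    case True
    have "n * (x * card {y \<in> E. L y = s}) = x * (n * card {y \<in> E. L y = s})" by simp
    also have "\<dots> = w * (b * x)" by (simp add: cnt[OF True])
    also have "\<dots> = n * (w * k)" by (simp add: k)
    finally have "n * (x * card {y \<in> E. L y = s}) = n * (w * k)" .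
    then show ?thesis using n by simp
  next
    case False
    \<comment> \<open>The splitting theorem asks for divisibility at every natural number
      \<open>s\<close>; those outside \<open>{1..n}\<close> do not occur as entries.\<close>
    then have none: "{y \<in> E. L y = s} = {}" using rng by (fastforce simp: E_def)
    show ?thesis unfolding none by simp
  qed
  then obtain D where D: "D \<subseteq> E"
    "\<And>i. w * card {y \<in> D. fst y = i} = x * card {y \<in> E. fst y = i}"
    "\<And>s. w * card {y \<in> D. L y = s} = x * card {y \<in> E. L y = s}"
    using proportional_split[OF finE wx(1), of x fst L] row wx(2) by (auto split: if_splits)
  have finD: "finite D" using D(1) finE finite_subset by blast
  have rowD: "card {y \<in> D. fst y = i} = x" if "i \<in> {1..b}" for i
    using D(2)[of i] row[of i] that wx(1) by simp
  have symD: "n * card {y \<in> D. L y = s} = b * x" if "s \<in> {1..n}" for s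
  proof -
    have "w * (n * card {y \<in> D. L y = s}) = n * (w * card {y \<in> D. L y = s})" by simp
    also have "\<dots> = x * (n * card {y \<in> E. L y = s})" by (simp add: D(3))
    also have "\<dots> = w * (b * x)" by (simp add: cnt[OF that])
    finally have "w * (n * card {y \<in> D. L y = s}) = w * (b * x)" .
    then show ?thesis using wx(1) by simp
  qed
  have compl: "card {y \<in> E - D. P y} = card {y \<in> E. P y} - card {y \<in> D. P y}" for P
  proof -
    have "{y \<in> E - D. P y} = {y \<in> E. P y} - {y \<in> D. P y}" by auto
    then show ?thesis using D(1) finD by (simp add: card_Diff_subset Collect_mono_iff subset_iff)
  qed
  have rowC: "card {y \<in> E - D. fst y = i} = w - x" if "i \<in> {1..b}" for i
    using compl rowD[OF that] row[of i] that by simp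
  have symC: "n * card {y \<in> E - D. L y = s} = b * (w - x)" if "s \<in> {1..n}" for s
    using compl symD[OF that] cnt[OF that] by (simp add: diff_mult_distrib2)
  have reg2: "respects_regions F ({b + 1..n} \<times> {e + 1..d})"
  proof -
    have "{b + 1..n} \<times> {e + 1..d} = {b + 1..n} \<times> {c..d} - {b + 1..n} \<times> {c..e}"
      using e by auto
    then show ?thesis using respects_regions_Diff[OF regZ reg] by simp
  qed
  obtain L1 where L1: "balanced_strip n F b c e L1"
    "\<And>i. i \<in> {1..b} \<Longrightarrow> L1 ` ({i} \<times> {c..e}) = L ` {y \<in> D. fst y = i}"
    "\<And>i j. b < i \<Longrightarrow> L1 (i, j) = L (i, j)"
    by (rule balanced_substrip[OF bal _ _ _ reg D(1)[unfolded E_def]])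
      (use e rowD symD in \<open>auto simp: x_def\<close>)
  obtain L2 where L2: "balanced_strip n F b (e + 1) d L2"
    "\<And>i. i \<in> {1..b} \<Longrightarrow> L2 ` ({i} \<times> {e + 1..d}) = L ` {y \<in> E - D. fst y = i}"
    "\<And>i j. b < i \<Longrightarrow> L2 (i, j) = L (i, j)"
    by (rule balanced_substrip[OF bal _ _ _ reg2, of "E - D"])
      (use e rowC symC wx(3) in \<open>auto simp: E_def\<close>)
  have shorter: "e - c < d - c" "d - (e + 1) < d - c" using e by linarith+
  obtain L1' where L1': "column_latin_rearrangement n F b c e L1 L1'"
    using IH[OF shorter(1) L1(1)] by blast
  obtain L2' where L2': "column_latin_rearrangement n F b (e + 1) d L2 L2'"
    using IH[OF shorter(2) L2(1)] by blast
  define L' where "L' y = (if snd y \<le> e then L1' y else L2' y)" for y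
  have left: "L' ` A = L1' ` A" if "A \<subseteq> UNIV \<times> {c..e}" for A
    using that by (intro image_cong) (auto simp: L'_def)
  have right: "L' ` A = L2' ` A" if "A \<subseteq> UNIV \<times> {e + 1..d}" for A
    using that by (intro image_cong) (auto simp: L'_def)
  have "L' ` ({i} \<times> {c..d}) = L ` ({i} \<times> {c..d})" if i: "i \<in> {1..b}" for i
  proof -
    have "{i} \<times> {c..d} = {i} \<times> {c..e} \<union> {i} \<times> {e + 1..d}" using e by auto
    moreover have "L' ` ({i} \<times> {c..e}) = L1' ` ({i} \<times> {c..e})" by (rule left) auto
    moreover have "L' ` ({i} \<times> {e + 1..d}) = L2' ` ({i} \<times> {e + 1..d})" by (rule right) auto
    ultimately have "L' ` ({i} \<times> {c..d}) = L1' ` ({i} \<times> {c..e}) \<union> L2' ` ({i} \<times> {e + 1..d})"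
      by (simp only: image_Un)
    also have "\<dots> = L1 ` ({i} \<times> {c..e}) \<union> L2 ` ({i} \<times> {e + 1..d})"
      using L1' L2' i by (simp add: column_latin_rearrangement_def)
    also have "\<dots> = L ` ({y \<in> D. fst y = i} \<union> {y \<in> E - D. fst y = i})"
      by (simp add: L1(2)[OF i] L2(2)[OF i, simplified] image_Un)
    also have "{y \<in> D. fst y = i} \<union> {y \<in> E - D. fst y = i} = {i} \<times> {c..d}"
      using D(1) i by (auto simp: E_def)
    finally show ?thesis .
  qed
  moreover have "L' ` (R \<inter> {i} \<times> UNIV) = L ` (R \<inter> {i} \<times> UNIV)"
    if R: "R \<in> F" "R \<subseteq> {b + 1..n} \<times> {c..d}" for R i
  \<comment> \<open>The left block below the boundary is a union of regions, so \<open>R\<close>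
    lies entirely on one side of the cut.\<close>
  proof (cases "R \<subseteq> {b + 1..n} \<times> {c..e}")
    case True
    then have "L' ` (R \<inter> {i} \<times> UNIV) = L1' ` (R \<inter> {i} \<times> UNIV)"
      by (intro left) auto
    also have "\<dots> = L1 ` (R \<inter> {i} \<times> UNIV)"
      using L1' R True by (simp add: column_latin_rearrangement_def)
    also have "\<dots> = L ` (R \<inter> {i} \<times> UNIV)"
      using True L1(3) by (intro image_cong) auto
    finally show ?thesis .
  next
    case False
    then have "R \<inter> {b + 1..n} \<times> {c..e} = {}"
      using reg R(1) unfolding respects_regions_def by blast
    then have sub: "R \<subseteq> {b + 1..n} \<times> {e + 1..d}"
      using R(2) by fastforce
    then have "L' ` (R \<inter> {i} \<times> UNIV) = L2' ` (R \<inter> {i} \<times> UNIV)"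
      by (intro right) auto
    also have "\<dots> = L2 ` (R \<inter> {i} \<times> UNIV)"
      using L2' R sub by (simp add: column_latin_rearrangement_def)
    also have "\<dots> = L ` (R \<inter> {i} \<times> UNIV)"
      using sub L2(3) by (intro image_cong) auto
    finally show ?thesis .
  qed
  moreover have "bij_betw (\<lambda>i. L' (i, j)) {1..n} {1..n}" if j: "j \<in> {c..d}" for j
    using L1' L2' j by (cases "j \<le> e") (simp_all add: column_latin_rearrangement_def L'_def)
  ultimately have "column_latin_rearrangement n F b c d L L'"
    unfolding column_latin_rearrangement_def by simp
  then show ?thesis by blast
qed

text \<open>A region spanning the whole strip contains each symbol once, so absorbing its rows
  raises every frequency by one. Its area is \<open>n\<close>, so the balance equation gains
  \<open>n\<close> on both sides and the boundary can move down to \<open>b'\<close> with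
  \<open>L\<close> unchanged.\<close>

lemma absorb_region:
  assumes G: "gerechte_framework n F"
    and bal: "balanced_strip n F b c d L"
    and R': "{b + 1..b'} \<times> {c..d} \<in> F" "b < b'" "b' \<le> n"
    and IH: "balanced_strip n F b' c d L \<Longrightarrow> \<exists>L'. column_latin_rearrangement n F b' c d L L'"
  shows "\<exists>L'. column_latin_rearrangement n F b c d L L'"
proof -
  let ?R = "{b + 1..b'} \<times> {c..d}"
  have P: "partition_on (cells n) F" "\<forall>R\<in>F. card R = n"
    using G by (auto simp: gerechte_framework_def)
  have Z: "{b' + 1..n} \<times> {c..d} = {b + 1..n} \<times> {c..d} - ?R"
    using R' by auto
  have disj: "R \<inter> ?R = {}" if "R \<in> F" "R \<noteq> ?R" for R
    by (rule disjointD[OF partition_onD2[OF P(1)] that(1) R'(1) that(2)])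
  have R_cases: "R = ?R \<or> R \<subseteq> {b' + 1..n} \<times> {c..d}"
    if "R \<in> F" "R \<subseteq> {b + 1..n} \<times> {c..d}" for R
    unfolding Z using disj[OF that(1)] that(2) by blast
  have bnd: "1 \<le> c" "c \<le> d" "d \<le> n"
    and regZ: "respects_regions F ({b + 1..n} \<times> {c..d})"
    and low: "\<And>R. R \<in> F \<Longrightarrow> R \<subseteq> {b + 1..n} \<times> {c..d} \<Longrightarrow> bij_betw L R {1..n}"
    and rows: "\<And>i. i \<in> {1..b} \<Longrightarrow> inj_on L ({i} \<times> {c..d}) \<and> L ` ({i} \<times> {c..d}) \<subseteq> {1..n}"
    and cnt: "\<And>s. s \<in> {1..n} \<Longrightarrow> n * card {y \<in> {1..b} \<times> {c..d}. L y = s} = b * (d + 1 - c)"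
    using bal by (simp_all add: balanced_strip_def)
  have "?R \<subseteq> {b + 1..n} \<times> {c..d}" using R'(3) by auto
  then have bij: "bij_betw L ?R {1..n}" using low R'(1) by blast
  have "respects_regions F ({b' + 1..n} \<times> {c..d})"
    unfolding Z using respects_regions_Diff[OF regZ]
      respects_regions_Union[OF partition_onD2[OF P(1)], of "{?R}"] R'(1) by simp
  moreover have "bij_betw L R {1..n}" if "R \<in> F" "R \<subseteq> {b' + 1..n} \<times> {c..d}" for R
    using low that unfolding Z by blast
  moreover have "inj_on L ({i} \<times> {c..d}) \<and> L ` ({i} \<times> {c..d}) \<subseteq> {1..n}" if "i \<in> {1..b'}" for i
  proof (cases "i \<le> b")
    case False
    then have "{i} \<times> {c..d} \<subseteq> ?R" using that by auto
    then show ?thesis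
      using inj_on_subset[OF bij_betw_imp_inj_on[OF bij]] image_mono[of _ ?R L]
        bij_betw_imp_surj_on[OF bij] by metis
  qed (use rows that in auto)
  moreover have "n * card {y \<in> {1..b'} \<times> {c..d}. L y = s} = b' * (d + 1 - c)"
    if s: "s \<in> {1..n}" for s
  proof -
    obtain y where "y \<in> ?R" "L y = s"
      using bij s unfolding bij_betw_def by (metis imageE)
    then have "{z \<in> ?R. L z = s} = {y}"
      using bij unfolding bij_betw_def inj_on_def by blast
    then have one: "card {z \<in> ?R. L z = s} = 1" by simp
    have un: "{y \<in> {1..b'} \<times> {c..d}. L y = s} =
        {y \<in> {1..b} \<times> {c..d}. L y = s} \<union> {z \<in> ?R. L z = s}"
      using R'(2) by auto
    have "card {y \<in> {1..b'} \<times> {c..d}. L y = s} =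
        card {y \<in> {1..b} \<times> {c..d}. L y = s} + card {z \<in> ?R. L z = s}"
      unfolding un
    proof (rule card_Un_disjoint)
      show "finite {y \<in> {1..b} \<times> {c..d}. L y = s}" "finite {z \<in> ?R. L z = s}"
        by (rule finite_Collect_conjI, rule disjI1, simp)+
    qed auto
    then have "n * card {y \<in> {1..b'} \<times> {c..d}. L y = s} = b * (d + 1 - c) + n"
      by (simp only: one cnt[OF s] distrib_left mult_1_right)
    moreover have "card ?R = (b' - b) * (d + 1 - c)"
      by (simp add: card_cartesian_product)
    then have "n = (b' - b) * (d + 1 - c)"
      using bspec[OF P(2) R'(1)] by simp
    then have "b * (d + 1 - c) + n = (b + (b' - b)) * (d + 1 - c)"
      unfolding add_mult_distrib by (rule arg_cong)
    moreover have "b + (b' - b) = b'" using R'(2) by simp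
    ultimately show ?thesis by (simp only:)
  qed
  ultimately have "balanced_strip n F b' c d L"
    using bnd R'(3) by (simp add: balanced_strip_def)
  then obtain L' where L': "column_latin_rearrangement n F b' c d L L'"
    using IH by blast
  have rowL': "L' ` ({i} \<times> {c..d}) = L ` ({i} \<times> {c..d})" if "i \<in> {1..b'}" for i
    using L' that by (simp add: column_latin_rearrangement_def)
  \<comment> \<open>The rows of the absorbed region are now upper rows of the longer strip, and each
    is exactly the part of that row inside the region, so row images give what is required for
    it.\<close>
  have "L' ` (R \<inter> {i} \<times> UNIV) = L ` (R \<inter> {i} \<times> UNIV)"
    if R: "R \<in> F" "R \<subseteq> {b + 1..n} \<times> {c..d}" for R i
  proof (cases "R = ?R")
    case True
    show ?thesis
    proof (cases "i \<in> {b + 1..b'}")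
      case i: True
      then have "R \<inter> {i} \<times> UNIV = {i} \<times> {c..d}" unfolding True by auto
      then show ?thesis using rowL'[of i] i by simp
    next
      case False
      then have "R \<inter> {i} \<times> UNIV = {}" unfolding True by auto
      then show ?thesis by simp
    qed
  next
    case False
    then show ?thesis
      using R_cases[OF R] R(1) L' by (simp add: column_latin_rearrangement_def)
  qed
  then have "column_latin_rearrangement n F b c d L L'"
    using L' R'(2) by (simp add: column_latin_rearrangement_def)
  then show ?thesis by blast
qed

text \<open>Induction on the number of rows below the boundary plus the width. The region at the top
  left corner of the lower block decides the step: if it spans the strip it is absorbed; otherwise
  it and its bottom set form a full-height block of columns along which the strip is split.\<close>

lemma balanced_strip_rearrangement:
  assumes G: "gerechte_framework n F" and rect: "\<forall>R\<in>F. rectangle R" and tree: "tree_structured n F"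
  shows "balanced_strip n F b c d L \<Longrightarrow> \<exists>L'. column_latin_rearrangement n F b c d L L'"
proof (induction "(n - b) + (d - c)" arbitrary: b c d L rule: less_induct)
  case less
  note bal = less.prems
  have P: "partition_on (cells n) F"
    using G by (auto simp: gerechte_framework_def)
  have disj: "R \<inter> S = {}" if "R \<in> F" "S \<in> F" "R \<noteq> S" for R S
    by (rule disjointD[OF partition_onD2[OF P] that])
  have bnd: "1 \<le> c" "c \<le> d" "d \<le> n" "b \<le> n"
    and regZ: "respects_regions F ({b + 1..n} \<times> {c..d})"
    using bal by (auto simp: balanced_strip_def)
  have split: ?case if e: "c \<le> e" "e < d" "respects_regions F ({b + 1..n} \<times> {c..e})" for e
    by (rule split_strip[OF G bal e]) (use less.hyps in auto)
  consider "b = n" "c = d" | "b = n" "c < d" | "b < n" using bnd by linarith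
  then show ?case
  proof cases
    case 1
    \<comment> \<open>For a single column of full height the balance equation gives every symbol
      frequency one, so \<open>L\<close> itself is the required rearrangement.\<close>
    define f where "f i = L (i, c)" for i
    have "\<exists>i\<in>{1..n}. f i = s" if s: "s \<in> {1..n}" for s
    proof -
      have "n * card {x \<in> {1..n} \<times> {c..c}. L x = s} = n"
        using bal 1 s by (simp add: balanced_strip_def)
      then have "card {x \<in> {1..n} \<times> {c..c}. L x = s} \<noteq> 0"
        using s by (metis atLeastAtMost_iff le_zero_eq mult_0_right not_one_le_zero)
      then obtain x where "x \<in> {1..n} \<times> {c..c}" "L x = s"
        by (metis (mono_tags, lifting) card.empty empty_Collect_eq)
      then show ?thesis by (auto simp: f_def)
    qed
    moreover have "f i \<in> {1..n}" if "i \<in> {1..n}" for i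
      using bal 1 that by (auto simp: balanced_strip_def f_def)
    ultimately have im: "f ` {1..n} = {1..n}" by blast
    then have "inj_on f {1..n}" by (intro eq_card_imp_inj_on) auto
    then have "bij_betw f {1..n} {1..n}" using im by (simp add: bij_betw_def)
    then have "column_latin_rearrangement n F b c d L L"
      using 1 by (simp add: column_latin_rearrangement_def f_def[abs_def])
    then show ?thesis by blast
  next
    case 2
    \<comment> \<open>No rows remain below the boundary, so the empty block respects all regions and
      one column can be split off.\<close>
    then show ?thesis by (intro split[of c]) (auto simp: respects_regions_def)
  next
    case 3
    then have "(b + 1, c) \<in> cells n" using bnd by (auto simp: cells_def)
    then obtain R where R: "R \<in> F" "(b + 1, c) \<in> R"
      using partition_onD1[OF P] by blast
    obtain a b' c' e where abc: "a \<le> b'" "c' \<le> e" "R = {a..b'} \<times> {c'..e}"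
      using bspec[OF rect R(1)] unfolding rectangle_def by blast
    have "(b + 1, c) \<in> {b + 1..n} \<times> {c..d}" using 3 bnd by auto
    then have RZ: "R \<subseteq> {b + 1..n} \<times> {c..d}"
      by (rule respects_regionsD[OF regZ R])
    then have "{a..b'} \<subseteq> {b + 1..n}" "{c'..e} \<subseteq> {c..d}"
      using abc by (auto simp: times_subset_iff)
    \<comment> \<open>A rectangle inside the lower block that contains the corner cell must start in
      row \<open>b + 1\<close> and column \<open>c\<close>.\<close>
    then have bounds: "a = b + 1" "c' = c" "b < b'" "b' \<le> n" "c \<le> e" "e \<le> d"
      using abc R(2) by auto
    have Req: "R = {b + 1..b'} \<times> {c..e}" using abc bounds by simp
    show ?thesis
    proof (cases "e = d")
      case True
      show ?thesis
        by (rule absorb_region[OF G bal]) (use R(1) Req True bounds less.hyps 3 in auto)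
    next
      case False
      have "R \<subseteq> cells n" using R(1) partition_onD1[OF P] by blast
      then have "bottom_set n R = {b' + 1..n} \<times> {c..e}"
        unfolding Req using bounds by (intro bottom_set_rectangle) auto
      moreover obtain H where H: "H \<subseteq> F" "bottom_set n R = \<Union>H"
        using tree R(1) unfolding tree_structured_def by blast
      moreover have "{b + 1..n} \<times> {c..e} = R \<union> {b' + 1..n} \<times> {c..e}"
        using Req bounds by auto
      ultimately have Z: "{b + 1..n} \<times> {c..e} = \<Union>(insert R H)" by simp
      have "respects_regions F ({b + 1..n} \<times> {c..e})"
        unfolding Z using R(1) H(1) by (intro respects_regions_Union partition_onD2[OF P]) simp
      then show ?thesis using split[of e] False bounds by auto
    qed
  qed
qed

section \<open>Initial colouring of rows and regions, and conclusion\<close>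

lemma ex1_preimage:
  assumes "finite A" "g ` A = B" "card A = card B" "s \<in> B"
  shows "\<exists>!x. x \<in> A \<and> g x = s"
proof -
  have "inj_on g A" using assms by (intro eq_card_imp_inj_on) simp_all
  moreover obtain x where "x \<in> A" "g x = s" using assms(2,4) by blast
  ultimately show ?thesis by (metis inj_onD)
qed

theorem theorem10:
  fixes n :: nat and F :: "(nat \<times> nat) set set"
  assumes "gerechte_framework n F"
    and "\<forall>R\<in>F. rectangle R"
    and "tree_structured n F"
  shows "realizable n F"
proof (cases "n = 0")
  case True
  then have "cells n = {}" by (simp add: cells_def)
  then have "F = {}"
    using assms(1) by (simp add: gerechte_framework_def partition_on_empty)
  then show ?thesis
    using True by (auto simp: realizable_def realizes_def latin_square_def cells_def)
next
  case False
  have P: "partition_on (cells n) F" and card: "\<And>R. R \<in> F \<Longrightarrow> card R = n"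
    using assms(1) by (auto simp: gerechte_framework_def)
  have cover: "\<Union>F = cells n" using partition_onD1[OF P] by simp
  have disj: "R = S" if "R \<in> F" "S \<in> F" "x \<in> R" "x \<in> S" for R S x
    using partition_onD2[OF P] that unfolding disjoint_def by blast
  have fin: "finite (cells n)" by (simp add: cells_def)
  define v where "v x = (THE R. R \<in> F \<and> x \<in> R)" for x
  have v: "v x = R" if "R \<in> F" "x \<in> R" for x R
    unfolding v_def using that disj by (intro the_equality) blast+
  have v_in: "v x \<in> F" "x \<in> v x" if x: "x \<in> cells n" for x
  proof -
    obtain R where "R \<in> F" "x \<in> R" using x cover by blast
    then show "v x \<in> F" "x \<in> v x" using v by simp_all
  qed
  have row: "{x \<in> cells n. fst x = i} = (if i \<in> {1..n} then {i} \<times> {1..n} else {})" for i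
    by (auto simp: cells_def)
  have rowcard: "card {x \<in> cells n. fst x = i} = (if i \<in> {1..n} then n else 0)" for i
    by (simp add: row card_cartesian_product)
  have reg: "{x \<in> cells n. v x = R} = R" if "R \<in> F" for R
  proof
    show "{x \<in> cells n. v x = R} \<subseteq> R" using v_in(2) by blast
    show "R \<subseteq> {x \<in> cells n. v x = R}" using v[OF that] cover that by blast
  qed
  have regcard: "n dvd card {x \<in> cells n. v x = R}" for R
  proof (cases "R \<in> F")
    case False
    then have none: "{x \<in> cells n. v x = R} = {}" using v_in(1) by blast
    show ?thesis unfolding none by simp
  next
    case True
    show ?thesis unfolding reg[OF True] by (simp add: card True)
  qed
  have rowdvd: "n dvd card {x \<in> cells n. fst x = i}" for i
    by (simp add: rowcard)
  \<comment> \<open>The cells are the edges between rows and regions. All degrees are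
    \<open>n\<close> or zero, so with \<open>n\<close> colours each colour occurs exactly once in
    every row and every region.\<close>
  obtain col where col: "\<forall>x\<in>cells n. col x < n"
    "\<And>c i. c < n \<Longrightarrow> card {x \<in> cells n. fst x = i} = n * card {x \<in> cells n. fst x = i \<and> col x = c}"
    "\<And>c R. c < n \<Longrightarrow> card {x \<in> cells n. v x = R} = n * card {x \<in> cells n. v x = R \<and> col x = c}"
    using equitable_colouring[of "cells n" n fst v, OF fin _ rowdvd regcard] False by blast
  \<comment> \<open>Shifts the colours \<open>0\<close> to \<open>n - 1\<close> to the symbols
    \<open>1\<close> to \<open>n\<close>.\<close>
  define L where "L x = Suc (col x)" for x
  have bij: "bij_betw L A {1..n}"
    if A: "A \<subseteq> cells n" "card A = n" "\<And>c. c < n \<Longrightarrow> card A = n * card {x \<in> A. col x = c}" for A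
  proof -
    have finA: "finite A" using A(1) fin finite_subset by blast
    have "L ` A = {1..n}"
    proof
      show "L ` A \<subseteq> {1..n}" using A(1) col(1) by (auto simp: L_def Suc_le_eq)
      show "{1..n} \<subseteq> L ` A"
      proof
        fix s assume s: "s \<in> {1..n}"
        then have "s - 1 < n" by (simp add: Suc_le_eq[symmetric])
        then have "card {x \<in> A. col x = s - 1} \<noteq> 0"
          using A(2) A(3)[of "s - 1"] False by (intro notI) simp
        then obtain x where "x \<in> A" "col x = s - 1"
          by (metis (mono_tags, lifting) card.empty empty_Collect_eq)
        then show "s \<in> L ` A" using s by (auto simp: L_def intro!: image_eqI[of _ _ x])
      qed
    qed
    moreover from this have "inj_on L A"
      using A(2) finA by (intro eq_card_imp_inj_on) auto
    ultimately show ?thesis by (simp add: bij_betw_def)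
  qed
  have bijrow: "bij_betw L ({i} \<times> {1..n}) {1..n}" if i: "i \<in> {1..n}" for i
  proof (rule bij)
    fix c assume "c < n"
    have "{x \<in> cells n. fst x = i} = {i} \<times> {1..n}"
      "{x \<in> cells n. fst x = i \<and> col x = c} = {x \<in> {i} \<times> {1..n}. col x = c}"
      using i by (auto simp: cells_def)
    then show "card ({i} \<times> {1..n}) = n * card {x \<in> {i} \<times> {1..n}. col x = c}"
      using col(2)[OF \<open>c < n\<close>, of i] by (simp only:)
  qed (use i in \<open>auto simp: cells_def card_cartesian_product\<close>)
  have bijreg: "bij_betw L R {1..n}" if R: "R \<in> F" for R
  proof (rule bij)
    fix c assume "c < n"
    have "{x \<in> cells n. v x = R \<and> col x = c} = {x \<in> R. col x = c}"
      using reg[OF R] by blast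
    then show "card R = n * card {x \<in> R. col x = c}"
      using col(3)[OF \<open>c < n\<close>, of R] reg[OF R] by (simp only:)
  qed (use R card cover in auto)
  \<comment> \<open>The descent starts with the boundary above the first row: the upper part is
    empty, both sides of the balance equation are zero, and all regions lie below.\<close>
  have "balanced_strip n F 0 1 n L"
    using False bijreg respects_regions_Union[OF partition_onD2[OF P], of F, unfolded cover]
    by (simp add: balanced_strip_def cells_def)
  then obtain L' where L': "column_latin_rearrangement n F 0 1 n L L'"
    using balanced_strip_rearrangement[OF assms] by blast
  have sub: "R \<subseteq> {0 + 1..n} \<times> {1..n}" if "R \<in> F" for R
    using that cover by (auto simp: cells_def)
  have piece: "L' ` (R \<inter> {i} \<times> UNIV) = L ` (R \<inter> {i} \<times> UNIV)" if "R \<in> F" for R i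
    using L' that sub[OF that] unfolding column_latin_rearrangement_def by blast
  \<comment> \<open>The rearrangement preserves the symbols of each intersection of a region with a
    row. Uniting these over the rows recovers a region; uniting them over the regions, as in
    \<open>imrow\<close>, recovers a row.\<close>
  have imreg: "L' ` R = {1..n}" if R: "R \<in> F" for R
  proof -
    have "L' ` (\<Union>i. R \<inter> {i} \<times> UNIV) = L ` (\<Union>i. R \<inter> {i} \<times> UNIV)"
      by (simp only: image_UN piece[OF R])
    moreover have "(\<Union>i. R \<inter> {i} \<times> UNIV) = R" by auto
    ultimately show ?thesis using bij_betw_imp_surj_on[OF bijreg[OF R]] by simp
  qed
  have imrow: "L' ` ({i} \<times> {1..n}) = {1..n}" if i: "i \<in> {1..n}" for i
  proof -
    have "{i} \<times> {1..n} = cells n \<inter> {i} \<times> UNIV"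
      using i by (auto simp: cells_def)
    also have "\<dots> = (\<Union>R\<in>F. R \<inter> {i} \<times> UNIV)"
      unfolding cover[symmetric] by blast
    finally have "{i} \<times> {1..n} = (\<Union>R\<in>F. R \<inter> {i} \<times> UNIV)" .
    moreover have "L' ` (\<Union>R\<in>F. R \<inter> {i} \<times> UNIV) = L ` (\<Union>R\<in>F. R \<inter> {i} \<times> UNIV)"
      unfolding image_UN using piece by simp
    ultimately show ?thesis using bij_betw_imp_surj_on[OF bijrow[OF i]] by simp
  qed
  have "\<exists>!j. j \<in> {1..n} \<and> L' (i, j) = s" if "i \<in> {1..n}" "s \<in> {1..n}" for i s
  proof (rule ex1_preimage)
    have "{i} \<times> {1..n} = Pair i ` {1..n}" by auto
    then show "(\<lambda>j. L' (i, j)) ` {1..n} = {1..n}"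
      using imrow[OF that(1)] by (simp add: image_image)
  qed (use that in simp_all)
  moreover have "\<exists>!i. i \<in> {1..n} \<and> L' (i, j) = s" if "j \<in> {1..n}" "s \<in> {1..n}" for j s
  proof (rule ex1_preimage)
    show "(\<lambda>i. L' (i, j)) ` {1..n} = {1..n}"
      using L' that(1) by (simp add: column_latin_rearrangement_def bij_betw_def)
  qed (use that in simp_all)
  moreover have "L' x \<in> {1..n}" if "x \<in> cells n" for x
    using imreg[OF v_in(1)[OF that]] v_in(2)[OF that] by blast
  ultimately have "latin_square n L'"
    unfolding latin_square_def by simp
  moreover have "\<exists>!x. x \<in> R \<and> L' x = s" if "R \<in> F" "s \<in> {1..n}" for R s
  proof (rule ex1_preimage)
    have "R \<subseteq> cells n" using that(1) cover by blast
    then show "finite R" by (rule finite_subset[OF _ fin])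
    show "L' ` R = {1..n}" by (rule imreg[OF that(1)])
  qed (use that card in simp_all)
  ultimately have "realizes n L' F"
    unfolding realizes_def by simp
  then show ?thesis
    unfolding realizable_def by blast
qed

end
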